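(* Let $n$ be a positive integer and let $T_{\mathrm{PSSPM}}(n)$ be the shortest length (number of transitions) to reach a fixed point in $\mathrm{PSSPM}(n)$, starting from the single-column configuration $(n)$. Then $$n-\lfloor\sqrt n\rfloor\le T_{\mathrm{PSSPM}}(n)\le n.$$
   Context: A configuration assigns to each position $i\in\mathbb{Z}$ a height $a_i\in\mathbb{Z}_{\ge 0}$, with only finitely many nonzero heights. The initial configuration $(n)$ has $n$ grains in one column (position $0$) and height $0$ elsewhere. Column $i$ is right collapsible if $a_i-a_{i+1}\ge 2$; collapsing on the right moves one grain from column $i$ to column $i+1$. Column $i$ is left collapsible if $a_i-a_{i-1}\ge 2$; collapsing on the left moves one grain from column $i$ to column $i-1$. $\mathrm{PSSPM}$ rule (one transition): all columns that are collapsible (on at least one side) in the current configuration collapse simultaneously, each exactly once; a column collapsible on both sides collapses in exactly one of the two directions (chosen freely), and a column collapsible on only one side collapses on that side. $\mathrm{PSSPM}(n)$ is the set of configurations reachable from $(n)$ by finitely many transitions. A fixed point is a reachable configuration having no collapsible column. *)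

theory Defs
  imports Complex_Main "HOL-Library.Extended_Nat"
begin

type_synonym config = "int \<Rightarrow> nat"

definition is_config :: "config \<Rightarrow> bool" where
  "is_config a \<longleftrightarrow> finite {i. a i \<noteq> 0}"

definition single_column :: "nat \<Rightarrow> config" where
  "single_column n = (\<lambda>i. if i = 0 then n else 0)"

definition right_collapsible :: "config \<Rightarrow> int \<Rightarrow> bool" where
  "right_collapsible a i \<longleftrightarrow> int (a i) - int (a (i + 1)) \<ge> 2"

definition left_collapsible :: "config \<Rightarrow> int \<Rightarrow> bool" where
  "left_collapsible a i \<longleftrightarrow> int (a i) - int (a (i - 1)) \<ge> 2"

definition collapsible :: "config \<Rightarrow> int \<Rightarrow> bool" where
  "collapsible a i \<longleftrightarrow> right_collapsible a i \<or> left_collapsible a i"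

text \<open>\<open>R\<close> and \<open>L\<close> are the sets of columns collapsing on the right and on the left.
  The truncated subtraction below is exact: a collapsible column has height at least 2.\<close>

definition collapse :: "int set \<Rightarrow> int set \<Rightarrow> config \<Rightarrow> config" where
  "collapse R L a = (\<lambda>i. a i - of_bool (i \<in> R \<union> L) + of_bool (i - 1 \<in> R) + of_bool (i + 1 \<in> L))"

text \<open>A configuration without collapsible columns is related exactly to itself
  (\<open>R = L = {}\<close>), which does not affect shortest lengths.\<close>

definition psspm_step :: "config \<Rightarrow> config \<Rightarrow> bool" where
  "psspm_step a b \<longleftrightarrow>
     (\<exists>R L. R \<subseteq> {i. right_collapsible a i} \<and> L \<subseteq> {i. left_collapsible a i} \<and>
            R \<inter> L = {} \<and> R \<union> L = {i. collapsible a i} \<and> b = collapse R L a)"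

definition PSSPM :: "nat \<Rightarrow> config set" where
  "PSSPM n = {a. psspm_step\<^sup>*\<^sup>* (single_column n) a}"

definition PSSPM_fixed_points :: "nat \<Rightarrow> config set" where
  "PSSPM_fixed_points n = {a \<in> PSSPM n. \<forall>i. \<not> collapsible a i}"

text \<open>The infimum is taken in \<^typ>\<open>enat\<close>, so \<open>T_PSSPM n\<close> is finite only if
  some fixed point is actually reachable.\<close>

definition T_PSSPM :: "nat \<Rightarrow> enat" where
  "T_PSSPM n =
     (INF k \<in> {k. \<exists>a \<in> PSSPM_fixed_points n. (psspm_step ^^ k) (single_column n) a}. enat k)"

text \<open>Finiteness of the support need not be imposed in the definition of \<^const>\<open>PSSPM\<close>.\<close>

lemma is_config_step:
  assumes "is_config a" "psspm_step a b"
  shows "is_config b"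
proof -
  let ?S = "{i. a i \<noteq> 0}"
  obtain R L where R: "R \<subseteq> {i. right_collapsible a i}" and L: "L \<subseteq> {i. left_collapsible a i}"
    and b: "b = collapse R L a"
    using assms(2) unfolding psspm_step_def by blast
  have RS: "R \<subseteq> ?S" using R by (auto simp: right_collapsible_def)
  have LS: "L \<subseteq> ?S" using L by (auto simp: left_collapsible_def)
  have "{i. b i \<noteq> 0} \<subseteq> ?S \<union> (\<lambda>i. i + 1) ` ?S \<union> (\<lambda>i. i - 1) ` ?S"
  proof
    fix i assume "i \<in> {i. b i \<noteq> 0}"
    then have "a i \<noteq> 0 \<or> i - 1 \<in> R \<or> i + 1 \<in> L"
      by (auto simp: b collapse_def split: if_splits)
    then show "i \<in> ?S \<union> (\<lambda>i. i + 1) ` ?S \<union> (\<lambda>i. i - 1) ` ?S"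
      using RS LS by (auto simp: image_iff intro: exI[of _ "i - 1"] exI[of _ "i + 1"])
  qed
  then show ?thesis
    using assms(1) unfolding is_config_def by (elim finite_subset) auto
qed

lemma is_config_PSSPM:
  assumes "a \<in> PSSPM n"
  shows "is_config a"
proof -
  have "psspm_step\<^sup>*\<^sup>* (single_column n) a" using assms by (simp add: PSSPM_def)
  then show ?thesis
  proof (induction rule: rtranclp_induct)
    case base
    show ?case by (auto simp: is_config_def single_column_def)
  next
    case (step y z)
    then show ?case by (blast intro: is_config_step)
  qed
qed

end

theory Submission
  imports Defs
begin

text \<open>Lower bound: column 0 loses at most one grain per transition, and a fixed point whose column 0
  has height \<open>h\<close> contains at least \<open>h\<^sup>2\<close> grains, as neighbouring heights differ by at most 1.

  Upper bound: let column 0 send its grains alternately to the right and to the left. The two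
  sides are then monotone staircases fed every other step. Consecutive avalanches on a side do not
  interfere because they are two columns apart, and the left side repeats the right side with a
  delay of one step. When column 0, of height \<open>c\<close>, can no longer follow the alternation, \<open>n - c\<close>
  steps have passed and column 0 is stable for good. The avalanches still running move outwards one
  column per step, inside the first \<open>c\<close> columns of their side, hence they die within \<open>c\<close> steps.\<close>

section \<open>The lower bound\<close>

lemma step_center:
  assumes "psspm_step a b"
  shows "a i \<le> b i + 1"
proof -
  obtain R L where b: "b = collapse R L a" using assms unfolding psspm_step_def by blast
  have "a i - 1 \<le> a i - of_bool (i \<in> R \<union> L)" by (simp add: of_bool_def)
  then show ?thesis unfolding b collapse_def by linarith
qed

lemma steps_center:
  assumes "(psspm_step ^^ k) a b"
  shows "a i \<le> b i + k"
  using assms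
proof (induction k arbitrary: b)
  case (Suc k)
  then obtain b' where "(psspm_step ^^ k) a b'" "psspm_step b' b" by auto
  with Suc.IH[of b'] step_center[of b' b i] show ?case by simp
qed simp

section \<open>Conservation of the number of grains\<close>

lemma sum_of_bool_vimage:
  fixes f :: "int \<Rightarrow> int"
  assumes "finite A" "finite R" "inj f" "f -` R \<subseteq> A" "surj f"
  shows "(\<Sum>i\<in>A. of_bool (f i \<in> R)) = (card R :: nat)"
proof -
  have "(\<Sum>i\<in>A. of_bool (f i \<in> R)) = card (A \<inter> {i. f i \<in> R})"
    using assms(1) by simp
  also have "A \<inter> {i. f i \<in> R} = f -` R" using assms(4) by auto
  also have "card (f -` R) = card R"
    using assms by (intro card_vimage_inj) auto
  finally show ?thesis .
qed

text \<open>Each member of \<open>R \<union> L\<close> loses one grain to its chosen neighbour;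
  since \<open>R\<close> and \<open>L\<close> are disjoint, losses and gains are equal in
  number.\<close>

lemma step_sum:
  assumes "is_config a" "psspm_step a b"
  shows "sum b {i. b i \<noteq> 0} = sum a {i. a i \<noteq> 0}"
proof -
  obtain R L where R: "R \<subseteq> {i. right_collapsible a i}" and L: "L \<subseteq> {i. left_collapsible a i}"
    and RL: "R \<inter> L = {}" and b: "b = collapse R L a"
    using assms(2) unfolding psspm_step_def by blast
  have RS: "R \<union> L \<subseteq> {i. a i \<noteq> 0}"
    using R L by (auto simp: right_collapsible_def left_collapsible_def)
  have fin: "finite {i. a i \<noteq> 0}" "finite {i. b i \<noteq> 0}"
    using assms is_config_step[OF assms] by (simp_all add: is_config_def)
  have fR: "finite R" "finite L" using RS fin finite_subset by blast+
  \<comment> \<open>A common finite window: both supports and all receiving columns lie in it, so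
    each indicator sum over it counts a whole set.\<close>
  define A where "A = {i. a i \<noteq> 0} \<union> {i. b i \<noteq> 0} \<union> (\<lambda>i. i - 1) -` R \<union> (\<lambda>i. i + 1) -` L"
  have fA: "finite A"
    unfolding A_def using fin fR by (intro finite_UnI finite_vimageI) (auto simp: inj_def)
  have surj: "surj (\<lambda>i::int. i - 1)" "surj (\<lambda>i::int. i + 1)"
    by (rule surjI[where f = "\<lambda>i. i + 1"], simp) (rule surjI[where f = "\<lambda>i. i - 1"], simp)
  have s1: "(\<Sum>i\<in>A. of_bool (i - 1 \<in> R)) = card R"
    by (rule sum_of_bool_vimage[OF fA]) (use fR surj in \<open>auto simp: inj_def A_def\<close>)
  have s2: "(\<Sum>i\<in>A. of_bool (i + 1 \<in> L)) = card L"
    by (rule sum_of_bool_vimage[OF fA]) (use fR surj in \<open>auto simp: inj_def A_def\<close>)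
  have "(\<Sum>i\<in>A. of_bool (id i \<in> R \<union> L)) = card (R \<union> L)"
    by (rule sum_of_bool_vimage[OF fA]) (use fR RS in \<open>auto simp: A_def\<close>)
  then have s3: "(\<Sum>i\<in>A. of_bool (i \<in> R \<union> L)) = card R + card L"
    using RL fR by (simp add: card_Un_disjoint)
  \<comment> \<open>With the losses on the left no truncated subtraction remains; by
    \<open>RS\<close> a collapsing column is nonempty.\<close>
  have "b i + of_bool (i \<in> R \<union> L) = a i + of_bool (i - 1 \<in> R) + of_bool (i + 1 \<in> L)" for i
    using RS by (auto simp: b collapse_def)
  then have "(\<Sum>i\<in>A. b i + of_bool (i \<in> R \<union> L)) =
      (\<Sum>i\<in>A. a i + of_bool (i - 1 \<in> R) + of_bool (i + 1 \<in> L))" by (intro sum.cong refl)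
  then have "sum b A = sum a A" by (simp only: sum.distrib s1 s2 s3)
  moreover have "sum a A = sum a {i. a i \<noteq> 0}"
    by (rule sum.mono_neutral_right[OF fA]) (auto simp: A_def)
  moreover have "sum b A = sum b {i. b i \<noteq> 0}"
    by (rule sum.mono_neutral_right[OF fA]) (auto simp: A_def)
  ultimately show ?thesis by simp
qed

lemma PSSPM_sum:
  assumes "a \<in> PSSPM n"
  shows "sum a {i. a i \<noteq> 0} = n"
proof -
  have "psspm_step\<^sup>*\<^sup>* (single_column n) a" using assms by (simp add: PSSPM_def)
  then show ?thesis
  proof (induction rule: rtranclp_induct)
    case base
    show ?case by (cases "n = 0") (auto simp: single_column_def)
  next
    case (step y z)
    then show ?case using step_sum[of y z] is_config_PSSPM[of y n] by (simp add: PSSPM_def)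
  qed
qed

text \<open>At \<open>m = h\<close> the value is \<open>h * h\<close>. The width \<open>m\<close> is
  kept separate so that the induction can leave \<open>h\<close> fixed.\<close>

lemma sum_pyramid:
  "(\<Sum>i\<in>{- int m..int m}. int h - \<bar>i\<bar>) = (2 * int m + 1) * int h - int m * (int m + 1)"
proof (induction m)
  case (Suc m)
  have "{- int (Suc m)..int (Suc m)} =
      insert (int (Suc m)) (insert (- int (Suc m)) {- int m..int m})" by auto
  then show ?case using Suc by (simp add: algebra_simps)
qed simp

lemma fixed_point_height:
  assumes "a \<in> PSSPM_fixed_points n"
  shows "a 0 * a 0 \<le> n"
proof -
  have P: "a \<in> PSSPM n" and st: "\<And>i. \<not> collapsible a i"
    using assms by (auto simp: PSSPM_fixed_points_def)
  define h where "h = a 0"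
  have up: "int h - int m \<le> int (a (int m))" for m
  proof (induction m)
    case (Suc m)
    have "int (a (int m)) - int (a (int m + 1)) < 2"
      using st[of "int m"] by (auto simp: collapsible_def right_collapsible_def)
    with Suc show ?case by (simp add: add.commute)
  qed (simp add: h_def)
  have down: "int h - int m \<le> int (a (- int m))" for m
  proof (induction m)
    case (Suc m)
    have "int (a (- int m)) - int (a (- int m - 1)) < 2"
      using st[of "- int m"] by (auto simp: collapsible_def left_collapsible_def)
    moreover have e: "- int (Suc m) = - int m - 1" by simp
    ultimately show ?case using Suc unfolding e by simp
  qed (simp add: h_def)
  have pyr: "int h - \<bar>i\<bar> \<le> int (a i)" for i
    using up[of "nat i"] down[of "nat (- i)"] by (cases "i \<ge> 0") auto
  have fin: "finite {i. a i \<noteq> 0}" using is_config_PSSPM[OF P] by (simp add: is_config_def)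
  \<comment> \<open>The window ends where the pyramid reaches 0; farther out its formula is negative
    and would lower the total.\<close>
  have "int h * int h = (\<Sum>i\<in>{- int h..int h}. int h - \<bar>i\<bar>)"
    by (simp add: sum_pyramid algebra_simps)
  also have "\<dots> \<le> (\<Sum>i\<in>{- int h..int h}. int (a i))" by (intro sum_mono pyr)
  also have "\<dots> \<le> (\<Sum>i\<in>{- int h..int h} \<union> {i. a i \<noteq> 0}. int (a i))"
    using fin by (intro sum_mono2) auto
  also have "\<dots> = (\<Sum>i\<in>{i. a i \<noteq> 0}. int (a i))"
    by (rule sum.mono_neutral_right) (use fin in auto)
  also have "\<dots> = int n" using PSSPM_sum[OF P] by (simp flip: of_nat_sum)
  finally show ?thesis unfolding h_def by (simp flip: of_nat_mult)
qed

section \<open>The evolution of one side\<close>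

text \<open>\<open>f j\<close> is the height of the column at distance \<open>j + 1\<close> from column 0; \<open>r\<close> tells whether
  column 0 sends a grain to this side.\<close>

definition side_step :: "bool \<Rightarrow> (nat \<Rightarrow> nat) \<Rightarrow> nat \<Rightarrow> nat" where
  "side_step r f j = f j - of_bool (f (Suc j) + 2 \<le> f j)
     + (case j of 0 \<Rightarrow> of_bool r | Suc i \<Rightarrow> of_bool (f j + 2 \<le> f i))"

lemma side_step_0: "side_step r f 0 = f 0 - of_bool (f 1 + 2 \<le> f 0) + of_bool r"
  by (simp add: side_step_def)

lemma side_step_Suc: "side_step r f (Suc j) =
    f (Suc j) - of_bool (f (Suc (Suc j)) + 2 \<le> f (Suc j)) + of_bool (f (Suc j) + 2 \<le> f j)"
  by (simp add: side_step_def)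

text \<open>A descent of 2 is an avalanche in progress. Avalanches sit only at indices of one parity (even iff
  \<open>p\<close>), each leaves a plateau right behind it, and by the last conjunct any two plateaus are separated
  by an avalanche.\<close>

definition side_inv :: "bool \<Rightarrow> (nat \<Rightarrow> nat) \<Rightarrow> bool" where
  "side_inv p f \<longleftrightarrow>
     (\<forall>j. f (Suc j) \<le> f j \<and> f j \<le> f (Suc j) + 2) \<and>
     (\<forall>j. f j = f (Suc j) + 2 \<longrightarrow> even j = p) \<and>
     (\<forall>j. f (Suc j) = f (Suc (Suc j)) + 2 \<longrightarrow> f j = f (Suc j)) \<and>
     (\<forall>i j. i \<le> j \<longrightarrow> 0 < f j \<longrightarrow> f j + j \<le> f i + i + 1)"

lemma side_invD:
  assumes "side_inv p f"
  shows "f (Suc j) \<le> f j" "f j \<le> f (Suc j) + 2"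
    "f j = f (Suc j) + 2 \<Longrightarrow> even j = p"
    "f (Suc j) = f (Suc (Suc j)) + 2 \<Longrightarrow> f j = f (Suc j)"
    "i \<le> j \<Longrightarrow> 0 < f j \<Longrightarrow> f j + j \<le> f i + i + 1"
  using assms unfolding side_inv_def by blast+

lemma side_inv_zero: "side_inv p (\<lambda>_. 0)"
  by (simp add: side_inv_def)

text \<open>Write \<open>u j\<close> for an avalanche at \<open>j\<close>, with \<open>r\<close> as
  \<open>u (-1)\<close>: the drop at \<open>j\<close> changes by
  \<open>u (j - 1) - 2 * u j + u (j + 1)\<close>. Parity forbids adjacent avalanches and each has a
  plateau behind it, so drops stay between 0 and 2, and 2 arises only from a grain sent by index
  \<open>j - 1\<close> (by column 0 if \<open>j = 0\<close>). Feeding requires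
  \<open>\<not> p\<close> so that index 0 carries no avalanche at that moment.\<close>

lemma side_step_slope:
  assumes inv: "side_inv p f" and r: "r \<Longrightarrow> \<not> p"
  shows "side_step r f (Suc j) \<le> side_step r f j"
    "side_step r f j \<le> side_step r f (Suc j) + 2"
    "side_step r f j = side_step r f (Suc j) + 2 \<Longrightarrow> even j = (\<not> p)"
    "side_step r f j = side_step r f (Suc j) + 2 \<Longrightarrow>
      (case j of 0 \<Rightarrow> r | Suc i \<Rightarrow> f (Suc i) + 2 \<le> f i)"
proof -
  note D = side_invD[OF inv]
  let ?g = "side_step r f"
  define u where "u j \<longleftrightarrow> f (Suc j) + 2 \<le> f j" for j
  have ud: "u j \<Longrightarrow> f j = f (Suc j) + 2" and nud: "\<not> u j \<Longrightarrow> f j \<le> f (Suc j) + 1"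
    and up: "u j \<Longrightarrow> even j = p" and uf: "u (Suc j) \<Longrightarrow> f j = f (Suc j)" for j
    using D(2-4)[of j] D(2)[of "Suc j"] by (auto simp: u_def)
  have g0: "?g 0 = f 0 - of_bool (u 0) + of_bool r"
    and gS: "?g (Suc j) = f (Suc j) - of_bool (u (Suc j)) + of_bool (u j)" for j
    by (simp_all add: side_step_0 side_step_Suc u_def)
  have "?g (Suc j) \<le> ?g j \<and> ?g j \<le> ?g (Suc j) + 2 \<and>
      (?g j = ?g (Suc j) + 2 \<longrightarrow> even j = (\<not> p) \<and> (case j of 0 \<Rightarrow> r | Suc i \<Rightarrow> u i))"
  proof (cases j)
    case 0
    show ?thesis
    proof (cases "u 0")
      case True
      then have "\<not> r" "\<not> u 1" using up[of 0] up[of 1] r by auto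
      then show ?thesis using True D(1)[of 1] ud[of 0] 0 g0 gS[of 0] by simp
    next
      case False
      moreover have "u 1 \<Longrightarrow> f 0 = f 1 \<and> f 1 \<noteq> 0" using uf[of 0] ud[of 1] by simp
      ultimately show ?thesis
        using D(1)[of 0] nud[of 0] r 0 g0 gS[of 0] by (cases "u 1"; cases r) simp_all
    qed
  next
    case (Suc i)
    show ?thesis
    proof (cases "u j")
      case True
      then have "\<not> u i" "\<not> u (Suc j)" using up[of i] up[of j] up[of "Suc j"] Suc by auto
      then show ?thesis using True D(1)[of "Suc j"] ud[of j] Suc by (simp add: gS)
    next
      case False
      moreover have "u (Suc j) \<Longrightarrow> f j = f (Suc j) \<and> f (Suc j) \<noteq> 0" using uf[of j] ud[of "Suc j"] by simp
      moreover have "u i \<Longrightarrow> even j = (\<not> p)" using up[of i] Suc by auto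
      ultimately show ?thesis
        using D(1)[of j] nud[of j] Suc by (cases "u i"; cases "u (Suc j)") (simp_all add: gS)
    qed
  qed
  then show "?g (Suc j) \<le> ?g j" "?g j \<le> ?g (Suc j) + 2"
    "?g j = ?g (Suc j) + 2 \<Longrightarrow> even j = (\<not> p)"
    "?g j = ?g (Suc j) + 2 \<Longrightarrow> (case j of 0 \<Rightarrow> r | Suc i \<Rightarrow> f (Suc i) + 2 \<le> f i)"
    unfolding u_def by blast+
qed

lemma side_inv_step:
  assumes inv: "side_inv p f" and r: "r \<Longrightarrow> \<not> p"
  shows "side_inv (\<not> p) (side_step r f)"
proof -
  note D = side_invD[OF inv]
  let ?g = "side_step r f"
  note slope = side_step_slope[of p f r, OF inv r]
  have plateau: "?g j = ?g (Suc j)" if a: "?g (Suc j) = ?g (Suc (Suc j)) + 2" for j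
  proof -
    \<comment> \<open>The new avalanche at \<open>Suc j\<close> continues an old one at
      \<open>j\<close>, whose collapse evens out both columns, as neither adjacent index is
      active.\<close>
    have "f (Suc j) + 2 \<le> f j" using slope(4)[OF _ a] by simp
    then have u: "f j = f (Suc j) + 2" using D(2)[of j] by simp
    have nu: "\<not> f (Suc (Suc j)) + 2 \<le> f (Suc j)" using D(2)[of "Suc j"] D(4)[of j] u by auto
    show ?thesis
    proof (cases j)
      case 0
      then have "\<not> r" using D(3)[OF u] r by auto
      then show ?thesis using u nu 0 by (simp add: side_step_0 side_step_Suc)
    next
      case (Suc i)
      then have "\<not> f (Suc i) + 2 \<le> f i" using D(2)[of i] D(4)[of i] D(3)[of i] D(3)[of j] u by auto
      then show ?thesis using u nu Suc by (simp add: side_step_Suc)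
    qed
  qed
  have glob: "?g j + j \<le> ?g i + i + 1" if ij: "i \<le> j" and pos: "0 < ?g j" for i j
  proof (cases "i = j")
    case False
    then obtain k where j: "j = Suc k" and ik: "i \<le> k" using ij by (cases j) auto
    define x y :: nat where "x = of_bool (f (Suc i) + 2 \<le> f i)" and "y = of_bool (f j + 2 \<le> f k)"
    have lower: "f i \<le> ?g i + x"
      by (cases i) (auto simp: side_step_0 side_step_Suc x_def)
    have upper: "?g j \<le> f j + y"
      by (simp add: j side_step_Suc y_def)
    show ?thesis
    proof (cases "i = k")
      case True
      then show ?thesis using slope(1)[of k] j by simp
    next
      case False
      then have ik: "Suc i \<le> k" using ik by simp
      \<comment> \<open>An avalanche at \<open>i\<close> sharpens the bound taken from
        \<open>Suc i\<close> by one, which pays for the grain lost by \<open>i\<close>.\<close>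
      have tail: "f m + m + x \<le> f i + i + 1" if "Suc i \<le> m" "0 < f m" for m
        using D(5)[of i m] D(5)[of "Suc i" m] that by (cases "f (Suc i) + 2 \<le> f i") (simp_all add: x_def)
      show ?thesis
      proof (cases "f j + 2 \<le> f k")
        \<comment> \<open>The drop of 2 at \<open>k\<close> pays for the grain gained by
          \<open>j\<close>, so the bound at \<open>k\<close> suffices.\<close>
        case True
        then show ?thesis using tail[OF ik] lower upper j by (simp add: y_def)
      next
        case False
        then have "?g j \<le> f j" using upper by (simp add: y_def)
        then show ?thesis using tail[of j] pos lower ik j by simp
      qed
    qed
  qed simp
  show ?thesis using slope(1-3) plateau glob unfolding side_inv_def by blast
qed

text \<open>An avalanche needs \<open>f j \<ge> 2\<close>, while the plateau bound from index 0
  gives \<open>f j + j \<le> f 0 + 1\<close>.\<close>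

lemma active_bound:
  assumes "side_inv p f" "f (Suc j) + 2 \<le> f j"
  shows "j < f 0"
  using side_invD(5)[OF assms(1), of 0 j] assms(2) by simp

text \<open>On an unfed side every avalanche continues one at the preceding index, so the lower
  bound \<open>x\<close> on their positions grows by one.\<close>

lemma active_moves:
  assumes inv: "side_inv p f" and x: "\<And>j. f (Suc j) + 2 \<le> f j \<Longrightarrow> x \<le> j"
    and act: "side_step False f (Suc j) + 2 \<le> side_step False f j"
  shows "Suc x \<le> j"
  using side_step_slope(2,4)[OF inv, of False j] x act by (cases j) force+

section \<open>The upper bound\<close>

definition two_sided :: "nat \<Rightarrow> (nat \<Rightarrow> nat) \<Rightarrow> (nat \<Rightarrow> nat) \<Rightarrow> config" where
  "two_sided c f g i = (if i = 0 then c else if 0 < i then f (nat (i - 1)) else g (nat (- i - 1)))"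

lemma two_sided_simps:
  "two_sided c f g 0 = c"
  "two_sided c f g (1 + int j) = f j"
  "two_sided c f g (- 1 - int j) = g j"
  by (auto simp: two_sided_def)

lemma int_side_cases:
  obtains "i = 0" | j where "i = 1 + int j" | j where "i = - 1 - int j"
proof -
  have "i = 0 \<or> i = 1 + int (nat (i - 1)) \<or> i = - 1 - int (nat (- i - 1))" by linarith
  then show ?thesis using that by blast
qed

text \<open>The bound \<open>f 0 \<le> c + 1\<close> stops the first column from sending grains back
  to column 0; monotonicity does the same farther out.\<close>

lemma collapsible_right_side:
  assumes "\<And>j. f (Suc j) \<le> f j" "f 0 \<le> c + 1"
  shows "right_collapsible (two_sided c f g) (1 + int j) \<longleftrightarrow> f (Suc j) + 2 \<le> f j"
    "\<not> left_collapsible (two_sided c f g) (1 + int j)"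
proof -
  have *: "1 + int j + 1 = 1 + int (Suc j)" by simp
  show "right_collapsible (two_sided c f g) (1 + int j) \<longleftrightarrow> f (Suc j) + 2 \<le> f j"
    unfolding right_collapsible_def * two_sided_simps by linarith
  show "\<not> left_collapsible (two_sided c f g) (1 + int j)"
  proof (cases j)
    case 0
    then show ?thesis using assms(2) by (simp add: left_collapsible_def two_sided_def)
  next
    case (Suc i)
    then have "1 + int j - 1 = 1 + int i" by simp
    then show ?thesis
      using assms(1)[of i] Suc unfolding left_collapsible_def by (simp only: two_sided_simps)
  qed
qed

lemma collapsible_left_side:
  assumes "\<And>j. g (Suc j) \<le> g j" "g 0 \<le> c + 1"
  shows "left_collapsible (two_sided c f g) (- 1 - int j) \<longleftrightarrow> g (Suc j) + 2 \<le> g j"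
    "\<not> right_collapsible (two_sided c f g) (- 1 - int j)"
proof -
  have *: "- 1 - int j - 1 = - 1 - int (Suc j)" by simp
  show "left_collapsible (two_sided c f g) (- 1 - int j) \<longleftrightarrow> g (Suc j) + 2 \<le> g j"
    unfolding left_collapsible_def * two_sided_simps by linarith
  show "\<not> right_collapsible (two_sided c f g) (- 1 - int j)"
  proof (cases j)
    case 0
    then show ?thesis using assms(2) by (simp add: right_collapsible_def two_sided_def)
  next
    case (Suc i)
    then have "- 1 - int j + 1 = - 1 - int i" by simp
    then show ?thesis
      using assms(1)[of i] Suc unfolding right_collapsible_def by (simp only: two_sided_simps)
  qed
qed

lemma collapsible_center:
  "right_collapsible (two_sided c f g) 0 \<longleftrightarrow> f 0 + 2 \<le> c"
  "left_collapsible (two_sided c f g) 0 \<longleftrightarrow> g 0 + 2 \<le> c"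
  by (auto simp: right_collapsible_def left_collapsible_def two_sided_def)

text \<open>Since the sides collapse only outwards, column 0 is the only column that may have a
  choice, encoded by \<open>r\<close> and \<open>l\<close>, and each side evolves on its
  own.\<close>

lemma two_sided_step:
  assumes f: "\<And>j. f (Suc j) \<le> f j" "f 0 \<le> c + 1" and g: "\<And>j. g (Suc j) \<le> g j" "g 0 \<le> c + 1"
    and r: "r \<Longrightarrow> f 0 + 2 \<le> c" and l: "l \<Longrightarrow> g 0 + 2 \<le> c" and rl: "\<not> (r \<and> l)"
    and center: "f 0 + 2 \<le> c \<or> g 0 + 2 \<le> c \<Longrightarrow> r \<or> l"
  shows "psspm_step (two_sided c f g)
    (two_sided (c - of_bool (r \<or> l)) (side_step r f) (side_step l g))"
proof -
  let ?a = "two_sided c f g"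
  define R where "R = {i. right_collapsible ?a i \<and> (i = 0 \<longrightarrow> r)}"
  define L where "L = {i. left_collapsible ?a i \<and> (i = 0 \<longrightarrow> l)}"
  note cs = collapsible_right_side[where f = f and c = c, OF f]
    collapsible_left_side[where g = g and c = c, OF g] collapsible_center
  have RL: "R \<inter> L = {}"
  proof -
    have "i \<notin> R \<inter> L" for i
      by (cases i rule: int_side_cases) (use rl in \<open>auto simp: R_def L_def cs\<close>)
    then show ?thesis by blast
  qed
  have coll: "R \<union> L = {i. collapsible ?a i}"
  proof -
    have "i \<in> R \<union> L \<longleftrightarrow> collapsible ?a i" for i
      by (cases i rule: int_side_cases)
        (use center r l in \<open>auto simp: R_def L_def cs collapsible_def\<close>)
    then show ?thesis by blast
  qed
  have R0: "0 \<in> R \<longleftrightarrow> r" and Rr: "1 + int j \<in> R \<longleftrightarrow> f (Suc j) + 2 \<le> f j" and Rl: "- 1 - int j \<notin> R" for j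
    using r by (auto simp: R_def cs)
  have L0: "0 \<in> L \<longleftrightarrow> l" and Ll: "- 1 - int j \<in> L \<longleftrightarrow> g (Suc j) + 2 \<le> g j" and Lr: "1 + int j \<notin> L" for j
    using l by (auto simp: L_def cs)
  have "two_sided (c - of_bool (r \<or> l)) (side_step r f) (side_step l g) i = collapse R L ?a i" for i
  proof (cases i rule: int_side_cases)
    case 1
    then show ?thesis
      using R0 L0 Rl[of 0] Lr[of 0] by (simp add: collapse_def two_sided_simps)
  next
    case (2 j)
    have e: "1 + int j + 1 = 1 + int (Suc j)" by simp
    show ?thesis
    proof (cases j)
      case 0
      then show ?thesis
        using 2 R0 Rr[of 0] Lr[of 0] Lr[of 1] two_sided_simps(2)[of _ _ _ 0]
        by (simp add: collapse_def side_step_0)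
    next
      case (Suc k)
      then have "1 + int j - 1 = 1 + int k" by simp
      then show ?thesis unfolding 2 collapse_def e two_sided_simps using Suc
        by (simp only: Rr Lr side_step_Suc two_sided_simps Un_iff) simp
    qed
  next
    case (3 j)
    have e: "- 1 - int j - 1 = - 1 - int (Suc j)" by simp
    show ?thesis
    proof (cases j)
      case 0
      then show ?thesis
        using 3 L0 Ll[of 0] Rl[of 0] Rl[of 1] two_sided_simps(3)[of _ _ _ 0]
        by (simp add: collapse_def side_step_0)
    next
      case (Suc k)
      then have "- 1 - int j + 1 = - 1 - int k" by simp
      then show ?thesis unfolding 3 collapse_def e two_sided_simps using Suc
        by (simp only: Ll Rl side_step_Suc two_sided_simps Un_iff) simp
    qed
  qed
  then have "two_sided (c - of_bool (r \<or> l)) (side_step r f) (side_step l g) = collapse R L ?a" by (rule ext)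
  then show ?thesis
    unfolding psspm_step_def
    by (rule_tac x = R in exI, rule_tac x = L in exI) (use RL coll in \<open>auto simp: R_def L_def\<close>)
qed

section \<open>Time until stabilization\<close>

definition stabilizes_within :: "nat \<Rightarrow> config \<Rightarrow> bool" where
  "stabilizes_within m a \<longleftrightarrow> (\<exists>k\<le>m. \<exists>b. (psspm_step ^^ k) a b \<and> (\<forall>i. \<not> collapsible b i))"

lemma stabilizes_step:
  assumes "psspm_step a b" "stabilizes_within m b"
  shows "stabilizes_within (Suc m) a"
  using assms unfolding stabilizes_within_def by (meson Suc_le_mono relpowp_Suc_I2)

text \<open>Column 0 cannot collapse towards \<open>f\<close>. The last clause preserves this: an
  avalanche at index 0 lowers \<open>f 0\<close> by one, so it has to start from
  \<open>c = f 0\<close>.\<close>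

definition at_rest :: "nat \<Rightarrow> (nat \<Rightarrow> nat) \<Rightarrow> bool" where
  "at_rest c f \<longleftrightarrow> f 0 \<le> c \<and> c \<le> f 0 + 1 \<and> (f 1 + 2 \<le> f 0 \<longrightarrow> c = f 0)"

text \<open>After an unfed step index 0 carries no avalanche, so the last clause holds
  vacuously.\<close>

lemma at_rest_step:
  assumes "side_inv p f" "at_rest c f"
  shows "at_rest c (side_step False f)"
  using assms active_moves[OF assms(1), of 0 0]
  by (auto simp: at_rest_def side_step_0 of_bool_def split: if_splits)

text \<open>\<open>x\<close> is the remaining time: avalanches sit at index \<open>c - x\<close> or
  beyond and move out by one per step. At \<open>x = 0\<close> they would contradict
  \<open>active_bound\<close>, as \<open>f 0\<close> and \<open>g 0\<close> are at most
  \<open>c\<close>.\<close>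

lemma center_at_rest_stabilizes:
  assumes "side_inv p f" "side_inv q g" "at_rest c f" "at_rest c g"
    and "\<And>j. f (Suc j) + 2 \<le> f j \<Longrightarrow> c \<le> x + j" "\<And>j. g (Suc j) + 2 \<le> g j \<Longrightarrow> c \<le> x + j"
  shows "stabilizes_within x (two_sided c f g)"
  using assms
proof (induction x arbitrary: p q f g)
  case 0
  have "f 0 \<le> c" "g 0 \<le> c" using 0 by (simp_all add: at_rest_def)
  then have "\<not> f (Suc j) + 2 \<le> f j" "\<not> g (Suc j) + 2 \<le> g j" for j
    using active_bound[OF "0.prems"(1), of j] "0.prems"(5)[of j]
      active_bound[OF "0.prems"(2), of j] "0.prems"(6)[of j] by linarith+
  moreover have c: "\<not> f 0 + 2 \<le> c" "f 0 \<le> c + 1" "\<not> g 0 + 2 \<le> c" "g 0 \<le> c + 1"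
    using 0 by (auto simp: at_rest_def)
  moreover note collapsible_right_side[where f = f and c = c and g = g, OF side_invD(1)[OF "0.prems"(1)] c(2)]
    collapsible_left_side[where g = g and c = c and f = f, OF side_invD(1)[OF "0.prems"(2)] c(4)]
  ultimately have "\<not> collapsible (two_sided c f g) i" for i
    unfolding collapsible_def by (cases i rule: int_side_cases) (simp_all only: collapsible_center simp_thms)
  then show ?case unfolding stabilizes_within_def by (auto intro!: exI[of _ 0])
next
  case (Suc x)
  have "f 0 \<le> c + 1" "\<not> f 0 + 2 \<le> c" "g 0 \<le> c + 1" "\<not> g 0 + 2 \<le> c"
    using Suc.prems(3,4) by (auto simp: at_rest_def)
  then have "psspm_step (two_sided c f g)
      (two_sided (c - of_bool (False \<or> False)) (side_step False f) (side_step False g))"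
    by (intro two_sided_step side_invD(1)[OF Suc.prems(1)] side_invD(1)[OF Suc.prems(2)]) simp_all
  moreover have "stabilizes_within x (two_sided c (side_step False f) (side_step False g))"
  proof (rule Suc.IH)
    show "side_inv (\<not> p) (side_step False f)" "side_inv (\<not> q) (side_step False g)"
      using Suc.prems side_inv_step by auto
    show "at_rest c (side_step False f)" "at_rest c (side_step False g)"
      using Suc.prems at_rest_step by auto
    show "c \<le> x + j" if "side_step False f (Suc j) + 2 \<le> side_step False f j" for j
      using active_moves[OF Suc.prems(1) _ that, of "c - Suc x"] Suc.prems(5) by force
    show "c \<le> x + j" if "side_step False g (Suc j) + 2 \<le> side_step False g j" for j
      using active_moves[OF Suc.prems(2) _ that, of "c - Suc x"] Suc.prems(6) by force
  qed
  ultimately show ?case using stabilizes_step by simp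
qed

text \<open>The configurations met here are those at even times, when the right side is next to be fed.
  At that moment the left side is in the state which the right side had one step earlier.\<close>

lemma alternating_stabilizes:
  assumes "side_inv True g" "g 0 \<le> c"
  shows "stabilizes_within c (two_sided c (side_step False g) g)"
  using assms
proof (induction c arbitrary: g rule: less_induct)
  case (less c)
  define f where "f = side_step False g"
  define f1 where "f1 = side_step True f"
  have f: "side_inv False f"
    using side_inv_step[OF less.prems(1)] by (simp add: f_def)
  have f1: "side_inv True f1"
    using side_inv_step[OF f, of True] by (simp add: f1_def)
  note fd = side_invD(1)[OF f] and gd = side_invD(1)[OF less.prems(1)] and f1d = side_invD(1)[OF f1]
  have f0: "f 0 = g 0 - of_bool (g 1 + 2 \<le> g 0)" by (simp add: f_def side_step_0)
  \<comment> \<open>Avalanches of \<open>f\<close> sit at odd indices, so there is none at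
    0.\<close>
  have nf: "\<not> f 1 + 2 \<le> f 0"
    using side_invD(2,3)[OF f, of 0] by auto
  then have f10: "f1 0 = f 0 + 1" by (simp add: f1_def side_step_0)
  show ?case
  proof (cases "f 0 + 2 \<le> c")
    case False
    \<comment> \<open>With \<open>x = c\<close> the conditions on avalanche positions are
      trivial.\<close>
    have "stabilizes_within c (two_sided c f g)"
    proof (rule center_at_rest_stabilizes[OF f less.prems(1)])
      show "at_rest c f" using False nf f0 less.prems(2) by (simp add: at_rest_def)
      \<comment> \<open>If \<open>g\<close> has an avalanche at 0, then
        \<open>f 0 = g 0 - 1\<close>, and \<open>c \<le> f 0 + 1\<close> forces
        \<open>c = g 0\<close>.\<close>
      show "at_rest c g"
        using False f0 less.prems(2) by (cases "g 1 + 2 \<le> g 0") (simp_all add: at_rest_def)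
    qed simp_all
    then show ?thesis by (simp add: f_def)
  next
    case True
    have "psspm_step (two_sided c f g)
        (two_sided (c - of_bool (True \<or> False)) (side_step True f) (side_step False g))"
      using True less.prems(2) by (intro two_sided_step fd gd) simp_all
    \<comment> \<open>The left side now equals \<open>f\<close>, the state of the right side one
      step earlier.\<close>
    then have s1: "psspm_step (two_sided c f g) (two_sided (c - 1) f1 f)"
      by (simp add: f1_def f_def)
    have "stabilizes_within (c - 1) (two_sided (c - 1) f1 f)"
    proof (cases "f 0 + 3 \<le> c")
      case False
      \<comment> \<open>Column 0 can feed right but no longer left afterwards; this leaves a single
        value of \<open>c\<close>.\<close>
      have "c - 1 = f 0 + 1" using False True by simp
      then show ?thesis
        using nf f10 by (intro center_at_rest_stabilizes[OF f1 f]) (simp_all add: at_rest_def)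
    next
      case c3: True
      have "psspm_step (two_sided (c - 1) f1 f)
          (two_sided (c - 1 - of_bool (False \<or> True)) (side_step False f1) (side_step True f))"
        using c3 f10 by (intro two_sided_step fd f1d) simp_all
      \<comment> \<open>Two steps restore the initial shape with \<open>f1\<close> for
        \<open>g\<close> and two grains fewer in column 0.\<close>
      then have s2: "psspm_step (two_sided (c - 1) f1 f)
          (two_sided (c - 2) (side_step False f1) f1)"
        by (simp add: f1_def numeral_2_eq_2)
      have "stabilizes_within (c - 2) (two_sided (c - 2) (side_step False f1) f1)"
        by (rule less.IH) (use c3 f1 f10 in auto)
      from stabilizes_step[OF s2 this] show ?thesis
        using c3 by (simp add: numeral_2_eq_2 Suc_diff_Suc)
    qed
    from stabilizes_step[OF s1 this] show ?thesis using True by (simp add: f_def)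
  qed
qed

lemma single_column_stabilizes: "stabilizes_within n (single_column n)"
proof -
  have "side_step False (\<lambda>_. 0) = (\<lambda>_. 0)"
    by (rule ext) (simp add: side_step_def split: nat.split)
  moreover have "single_column n = two_sided n (\<lambda>_. 0) (\<lambda>_. 0)"
    by (rule ext) (simp add: single_column_def two_sided_def)
  ultimately show ?thesis
    using alternating_stabilizes[OF side_inv_zero, of n] by simp
qed

theorem corollary4:
  fixes n :: nat
  assumes "n > 0"
  shows "enat (n - nat \<lfloor>sqrt (real n)\<rfloor>) \<le> T_PSSPM n \<and> T_PSSPM n \<le> enat n"
proof
  show "enat (n - nat \<lfloor>sqrt (real n)\<rfloor>) \<le> T_PSSPM n"
    unfolding T_PSSPM_def
  proof (rule INF_greatest)
    fix k assume "k \<in> {k. \<exists>a \<in> PSSPM_fixed_points n. (psspm_step ^^ k) (single_column n) a}"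
    then obtain a where a: "a \<in> PSSPM_fixed_points n" "(psspm_step ^^ k) (single_column n) a"
      by blast
    have "n \<le> a 0 + k" using steps_center[OF a(2), of 0] by (simp add: single_column_def)
    moreover have "real (a 0) \<le> sqrt (real n)"
      using fixed_point_height[OF a(1)]
      by (intro real_le_rsqrt) (simp add: power2_eq_square flip: of_nat_mult)
    then have "a 0 \<le> nat \<lfloor>sqrt (real n)\<rfloor>" by (simp add: le_nat_floor)
    ultimately show "enat (n - nat \<lfloor>sqrt (real n)\<rfloor>) \<le> enat k" by simp
  qed
next
  obtain k a where k: "k \<le> n" and a: "(psspm_step ^^ k) (single_column n) a"
    "\<forall>i. \<not> collapsible a i"
    using single_column_stabilizes[of n] unfolding stabilizes_within_def by blast
  have "a \<in> PSSPM_fixed_points n"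
    using a relpowp_imp_rtranclp by (fastforce simp: PSSPM_fixed_points_def PSSPM_def)
  then have "T_PSSPM n \<le> enat k"
    unfolding T_PSSPM_def using a by (intro INF_lower) auto
  also have "\<dots> \<le> enat n" using k by simp
  finally show "T_PSSPM n \<le> enat n" .
qed

end
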